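(* The barcode form $\Lambda$ of a quiver representation of type $A_n$ (over a field $\mathbb F$, finite-dimensional, with a given choice of arrow directions) uniquely determines its isomorphism class.
   Context: A quiver representation of type $A_n$ assigns to the vertices $1,\dots,n$ of a line graph with directed edges finite-dimensional $\mathbb F$-vector spaces $V_1,\dots,V_n$ (with chosen bases) and to each directed edge between consecutive vertices a linear map (matrix) in the direction of the arrow. Two representations of the same directed graph are isomorphic if they differ by invertible changes of basis at the vertices. The companion matrix is the block matrix acting on $V=\bigoplus_iV_i$ whose non-zero blocks are the edge matrices, placed in the non-zero entries of the adjacency matrix of the directed graph; its block structure (the dimensions of the $V_i$) is part of the data. The interval representation $I[b,d]$ has $\mathbb F$ at the vertices $b,\dots,d$ and $0$ elsewhere, identity maps on edges between two copies of $\mathbb F$ and zero maps otherwise. A companion matrix $\Lambda$ is in barcode form if $\Lambda=PTP^T$ where $T$ is a direct sum of companion matrices of interval representations $I[b_i,d_i]$ and $P$ is a permutation matrix that regroups the basis vectors by vertex, so that $\Lambda$ has the block structure of a companion matrix. A barcode form of a representation with companion matrix $A$ is a $\Lambda$ in barcode form with $A=B\Lambda B^{-1}$ for some block-diagonal invertible $B$ with block sizes $\dim V_i$. *)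

theory Defs
  imports "Jordan_Normal_Form.Matrix" "HOL-Combinatorics.Permutations"
begin

text \<open>
  The vertices of the quiver are \<open>1, \<dots>, n\<close> and its edges are \<open>1, \<dots>, n - 1\<close>, edge \<open>e\<close> joining the
  vertices \<open>e\<close> and \<open>e + 1\<close>. An orientation is a predicate \<open>fwd\<close> on edges: \<open>fwd e\<close> says that the
  arrow is \<open>e \<rightarrow> e + 1\<close>, otherwise it is \<open>e + 1 \<rightarrow> e\<close>.
\<close>

definition source :: "(nat \<Rightarrow> bool) \<Rightarrow> nat \<Rightarrow> nat" where
  "source fwd e = (if fwd e then e else Suc e)"

definition target :: "(nat \<Rightarrow> bool) \<Rightarrow> nat \<Rightarrow> nat" where
  "target fwd e = (if fwd e then Suc e else e)"

text \<open>
  With chosen bases, a representation consists of the dimensions of the \<open>V\<^sub>i\<close> and the matrices of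
  the edge maps, which act on column vectors. Only the values at vertices in \<open>{1..n}\<close> and edges in
  \<open>{1..<n}\<close> are meaningful.
\<close>

record 'a quiver_rep =
  vdim :: "nat \<Rightarrow> nat"
  emap :: "nat \<Rightarrow> 'a mat"

definition is_rep :: "nat \<Rightarrow> (nat \<Rightarrow> bool) \<Rightarrow> 'a::field quiver_rep \<Rightarrow> bool" where
  "is_rep n fwd R \<longleftrightarrow>
     (\<forall>e\<in>{1..<n}. emap R e \<in> carrier_mat (vdim R (target fwd e)) (vdim R (source fwd e)))"

text \<open>An invertible matrix is square, so isomorphic representations have equal dimensions.\<close>

definition rep_iso ::
  "nat \<Rightarrow> (nat \<Rightarrow> bool) \<Rightarrow> 'a::field quiver_rep \<Rightarrow> 'a quiver_rep \<Rightarrow> bool" where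
  "rep_iso n fwd R S \<longleftrightarrow>
     (\<exists>\<phi>. (\<forall>i\<in>{1..n}. \<phi> i \<in> carrier_mat (vdim S i) (vdim R i) \<and> invertible_mat (\<phi> i)) \<and>
          (\<forall>e\<in>{1..<n}. \<phi> (target fwd e) * emap R e = emap S e * \<phi> (source fwd e)))"

text \<open>
  The ordered basis of \<open>V\<^sub>1 \<oplus> \<dots> \<oplus> V\<^sub>n\<close> is indexed by \<open>p < total_dim n d\<close>; the block of vertex \<open>i\<close>
  starts at \<open>block_start d i\<close>, and \<open>vertex_of d p\<close> is the vertex whose block contains \<open>p\<close>.
\<close>

definition total_dim :: "nat \<Rightarrow> (nat \<Rightarrow> nat) \<Rightarrow> nat" where
  "total_dim n d = (\<Sum>i\<in>{1..n}. d i)"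

definition block_start :: "(nat \<Rightarrow> nat) \<Rightarrow> nat \<Rightarrow> nat" where
  "block_start d i = (\<Sum>j\<in>{1..<i}. d j)"

definition vertex_of :: "(nat \<Rightarrow> nat) \<Rightarrow> nat \<Rightarrow> nat" where
  "vertex_of d p = (LEAST i. p < (\<Sum>j\<in>{1..i}. d j))"

text \<open>
  The block in row \<open>i\<close> and column \<open>j\<close> is the matrix of the edge from \<open>j\<close> to \<open>i\<close> if there is one, and
  zero otherwise. There is at most one such edge, so the sum below has at most one term.
\<close>

definition companion_matrix ::
  "nat \<Rightarrow> (nat \<Rightarrow> bool) \<Rightarrow> 'a::field quiver_rep \<Rightarrow> 'a mat" where
  "companion_matrix n fwd R =
     mat (total_dim n (vdim R)) (total_dim n (vdim R))
       (\<lambda>(p, q). let i = vertex_of (vdim R) p; j = vertex_of (vdim R) q in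
          \<Sum>e | e \<in> {1..<n} \<and> target fwd e = i \<and> source fwd e = j.
            emap R e $$ (p - block_start (vdim R) i, q - block_start (vdim R) j))"

definition interval_rep :: "(nat \<Rightarrow> bool) \<Rightarrow> nat \<Rightarrow> nat \<Rightarrow> 'a::field quiver_rep" where
  "interval_rep fwd b d =
     (let dm = (\<lambda>i. if b \<le> i \<and> i \<le> d then 1 else 0) in
      \<lparr>vdim = dm,
       emap = (\<lambda>e. if b \<le> e \<and> Suc e \<le> d then 1\<^sub>m 1
                   else 0\<^sub>m (dm (target fwd e)) (dm (source fwd e)))\<rparr>)"

text \<open>The permutation matrix sending the basis vector \<open>q\<close> to the basis vector \<open>\<pi> q\<close>.\<close>

definition perm_matrix :: "nat \<Rightarrow> (nat \<Rightarrow> nat) \<Rightarrow> 'a::field mat" where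
  "perm_matrix N \<pi> = mat N N (\<lambda>(p, q). if p = \<pi> q then 1 else 0)"

text \<open>
  \<open>barcode_sum\<close> is the matrix \<open>T\<close>. The basis of the summand \<open>I[b,d]\<close> has one vector at each of the
  vertices \<open>b, \<dots>, d\<close>, in this order, so \<open>barcode_vertices bars ! q\<close> is the vertex at which the
  \<open>q\<close>-th basis vector of the direct sum lives.
\<close>

definition barcode_sum ::
  "nat \<Rightarrow> (nat \<Rightarrow> bool) \<Rightarrow> (nat \<times> nat) list \<Rightarrow> 'a::field mat" where
  "barcode_sum n fwd bars =
     diag_block_mat (map (\<lambda>(b, d). companion_matrix n fwd (interval_rep fwd b d)) bars)"

definition barcode_vertices :: "(nat \<times> nat) list \<Rightarrow> nat list" where
  "barcode_vertices bars = concat (map (\<lambda>(b, d). [b..<Suc d]) bars)"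

text \<open>
  The matrix \<open>L\<close> with block structure \<open>\<delta>\<close> is in barcode form. That \<open>P = perm_matrix N \<pi>\<close> regroups
  the basis by vertex means that it moves each basis vector of the direct sum living at a vertex
  \<open>i\<close> into the \<open>i\<close>-th block; as \<open>\<pi>\<close> is a bijection, \<open>\<delta> i\<close> is then the number of intervals that
  contain \<open>i\<close>.
\<close>

definition in_barcode_form ::
  "nat \<Rightarrow> (nat \<Rightarrow> bool) \<Rightarrow> (nat \<Rightarrow> nat) \<Rightarrow> 'a::field mat \<Rightarrow> bool" where
  "in_barcode_form n fwd \<delta> L \<longleftrightarrow>
     (\<exists>bars \<pi>. let N = total_dim n \<delta>; P = perm_matrix N \<pi> in
        (\<forall>(b, d)\<in>set bars. 1 \<le> b \<and> b \<le> d \<and> d \<le> n) \<and>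
        length (barcode_vertices bars) = N \<and>
        \<pi> permutes {..<N} \<and>
        (\<forall>q<N. vertex_of \<delta> (\<pi> q) = barcode_vertices bars ! q) \<and>
        L = P * barcode_sum n fwd bars * transpose_mat P)"

text \<open>
  In \<open>similar_mat_wit A L P Q\<close> the matrix \<open>Q\<close> is the two-sided inverse of \<open>P\<close>, and \<open>A = P L Q\<close>.
\<close>

definition barcode_form_of ::
  "nat \<Rightarrow> (nat \<Rightarrow> bool) \<Rightarrow> 'a::field quiver_rep \<Rightarrow> (nat \<Rightarrow> nat) \<Rightarrow> 'a mat \<Rightarrow> bool" where
  "barcode_form_of n fwd R \<delta> L \<longleftrightarrow>
     in_barcode_form n fwd \<delta> L \<and>
     (\<forall>i\<in>{1..n}. \<delta> i = vdim R i) \<and>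
     (\<exists>B Q. (\<forall>i\<in>{1..n}. B i \<in> carrier_mat (vdim R i) (vdim R i)) \<and>
            similar_mat_wit (companion_matrix n fwd R) L
              (diag_block_mat (map B [1..<Suc n])) Q)"

end

theory Submission
  imports Defs
begin

text \<open>
  A barcode form of \<open>R\<close> is a barcode matrix that is similar to the companion matrix of \<open>R\<close> by a
  block-diagonal change of basis. The theorem therefore rests on two facts, neither of which
  concerns barcodes.

  The first is that the companion matrix carries the whole representation: two representations with
  the same dimensions are isomorphic iff their companion matrices are similar by a block-diagonal
  matrix (\<open>rep_iso_iff_block_similar\<close>). Indeed, a block-diagonal \<open>D\<close> with blocks
  \<open>B\<^sub>1, \<dots>, B\<^sub>n\<close> multiplies the block in row \<open>i\<close> and column \<open>j\<close> of a matrix by \<open>B\<^sub>i\<close> on the left or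
  by \<open>B\<^sub>j\<close> on the right. The only blocks of a companion matrix that can be nonzero are the edge maps,
  and no two edges share a block. So \<open>D\<close> intertwines the two companion matrices iff each square
  formed by an edge and the maps \<open>B\<^sub>i\<close> at its ends commutes
  (\<open>block_diag_intertwines_companion_iff\<close>), which is what it means for the \<open>B\<^sub>i\<close> to be a morphism of
  representations.

  The second is that block-diagonal similarity is symmetric and transitive, because products and
  inverses of block-diagonal matrices are block-diagonal (\<open>block_diag_mult\<close>,
  \<open>inverse_of_block_diag\<close>). Given a barcode form \<open>\<Lambda>\<close> of \<open>R\<close>, the companion matrix of \<open>S\<close> is thus
  similar in this sense to \<open>\<Lambda>\<close> iff it is similar to the companion matrix of \<open>R\<close>, that is, iff
  \<open>R\<close> and \<open>S\<close> are isomorphic.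
\<close>

section \<open>The ordered basis as a concatenation of the blocks\<close>

lemma block_start_Suc: "block_start d (Suc n) = total_dim n d"
  by (simp add: block_start_def total_dim_def atLeastLessThanSuc_atLeastAtMost)

lemma total_dim_Suc: "total_dim (Suc n) d = total_dim n d + d (Suc n)"
  by (simp add: total_dim_def)

lemma block_start_mono: "i \<le> j \<Longrightarrow> block_start d i \<le> block_start d j"
  unfolding block_start_def by (rule sum_mono2) auto

lemma block_start_add_le:
  assumes "1 \<le> i" "i < j"
  shows "block_start d i + d i \<le> block_start d j"
proof -
  obtain m where "i = Suc m"
    using assms(1) by (cases i) auto
  hence "block_start d i + d i = block_start d (Suc i)"
    by (simp add: block_start_Suc total_dim_Suc)
  thus ?thesis
    using block_start_mono[of "Suc i" j d] assms(2) by simp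
qed

lemma block_index_less:
  assumes "i \<in> {1..n}" "r < d i"
  shows "block_start d i + r < total_dim n d"
  using block_start_add_le[of i "Suc n" d] assms by (simp add: block_start_Suc)

lemma block_index_exists:
  "p < total_dim n d \<Longrightarrow> \<exists>i\<in>{1..n}. \<exists>r<d i. p = block_start d i + r"
proof (induction n)
  case 0
  thus ?case by (simp add: total_dim_def)
next
  case (Suc n)
  show ?case
  proof (cases "p < total_dim n d")
    case True
    with Suc.IH obtain i r where "i \<in> {1..n}" "r < d i" "p = block_start d i + r" by blast
    thus ?thesis by (intro bexI[of _ i]) auto
  next
    case False
    with Suc.prems show ?thesis
      by (intro bexI[of _ "Suc n"] exI[of _ "p - total_dim n d"])
        (auto simp: block_start_Suc total_dim_Suc)
  qed
qed

text \<open>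
  Cutting the summation over all basis vectors into one sum per vertex is what turns the matrix
  product into a product of block matrices.
\<close>

lemma sum_total_dim:
  fixes f :: "nat \<Rightarrow> 'b::comm_monoid_add"
  shows "(\<Sum>p<total_dim n d. f p) = (\<Sum>k\<in>{1..n}. \<Sum>t<d k. f (block_start d k + t))"
proof (induction n)
  case 0
  show ?case by (simp add: total_dim_def)
next
  case (Suc n)
  have "(\<Sum>p<total_dim n d + m. f p) = (\<Sum>p<total_dim n d. f p) + (\<Sum>t<m. f (total_dim n d + t))"
    for m by (induction m) (simp_all add: ac_simps)
  with Suc.IH show ?case
    by (simp add: total_dim_Suc block_start_Suc)
qed

text \<open>
  The block starting at \<open>block_start d i\<close> belongs to vertex \<open>i\<close> although neighbouring blocks may be
  empty: every vertex before \<open>i\<close> has its block end at or before \<open>block_start d i\<close>.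
\<close>

lemma vertex_of_block_index:
  assumes "1 \<le> i" "r < d i"
  shows "vertex_of d (block_start d i + r) = i"
  unfolding vertex_of_def total_dim_def[symmetric]
proof (rule Least_equality)
  show "block_start d i + r < total_dim i d"
    using assms by (intro block_index_less) auto
next
  fix j assume *: "block_start d i + r < total_dim j d"
  show "i \<le> j"
  proof (rule ccontr)
    assume "\<not> i \<le> j"
    hence "total_dim j d \<le> block_start d i"
      using block_start_mono[of "Suc j" i d] by (simp add: block_start_Suc)
    with * show False by simp
  qed
qed

section \<open>Blocks of a matrix\<close>

definition mat_block :: "(nat \<Rightarrow> nat) \<Rightarrow> 'a mat \<Rightarrow> nat \<Rightarrow> nat \<Rightarrow> 'a mat" where
  "mat_block d M i j = mat (d i) (d j) (\<lambda>(r, c). M $$ (block_start d i + r, block_start d j + c))"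

lemma mat_block_carrier [simp]: "mat_block d M i j \<in> carrier_mat (d i) (d j)"
  by (simp add: mat_block_def)

lemma mat_block_dim [simp]:
  "dim_row (mat_block d M i j) = d i" "dim_col (mat_block d M i j) = d j"
  by (simp_all add: mat_block_def)

lemma mat_block_index:
  "r < d i \<Longrightarrow> c < d j \<Longrightarrow>
     mat_block d M i j $$ (r, c) = M $$ (block_start d i + r, block_start d j + c)"
  by (simp add: mat_block_def)

lemma eq_mat_blockI:
  assumes M: "M \<in> carrier_mat (total_dim n d) (total_dim n d)"
    and M': "M' \<in> carrier_mat (total_dim n d) (total_dim n d)"
    and blocks: "\<And>i j. i \<in> {1..n} \<Longrightarrow> j \<in> {1..n} \<Longrightarrow> mat_block d M i j = mat_block d M' i j"
  shows "M = M'"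
proof (rule eq_matI)
  fix p q assume "p < dim_row M'" "q < dim_col M'"
  hence "p < total_dim n d" "q < total_dim n d" using M' by auto
  then obtain i j r c where "i \<in> {1..n}" "j \<in> {1..n}" and rc: "r < d i" "c < d j"
    and pq: "p = block_start d i + r" "q = block_start d j + c"
    by (meson block_index_exists)
  hence "mat_block d M i j $$ (r, c) = mat_block d M' i j $$ (r, c)"
    using blocks by simp
  thus "M $$ (p, q) = M' $$ (p, q)"
    using rc pq by (simp add: mat_block_index)
qed (use M M' in auto)

text \<open>
  Multiplication of block matrices. It is stated entrywise because the summands
  \<open>mat_block d M i k * mat_block d M' k j\<close> have sizes depending on \<open>i\<close> and \<open>j\<close>, so that they do not
  live in a type with a zero matrix over which one could sum.
\<close>

lemma mat_block_mult_index:
  fixes M M' :: "'a::semiring_0 mat"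
  assumes M: "M \<in> carrier_mat (total_dim n d) (total_dim n d)"
    and M': "M' \<in> carrier_mat (total_dim n d) (total_dim n d)"
    and ij: "i \<in> {1..n}" "j \<in> {1..n}" and rc: "r < d i" "c < d j"
  shows "mat_block d (M * M') i j $$ (r, c) =
           (\<Sum>k\<in>{1..n}. (mat_block d M i k * mat_block d M' k j) $$ (r, c))"
proof -
  have "mat_block d (M * M') i j $$ (r, c) =
          (\<Sum>p<total_dim n d. M $$ (block_start d i + r, p) * M' $$ (p, block_start d j + c))"
    using M M' rc block_index_less[of i n r d] block_index_less[of j n c d] ij
    by (simp add: mat_block_index scalar_prod_def atLeast0LessThan)
  also have "\<dots> = (\<Sum>k\<in>{1..n}. \<Sum>t<d k. M $$ (block_start d i + r, block_start d k + t)
                                 * M' $$ (block_start d k + t, block_start d j + c))"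
    by (rule sum_total_dim)
  also have "\<dots> = (\<Sum>k\<in>{1..n}. (mat_block d M i k * mat_block d M' k j) $$ (r, c))"
    using rc by (intro sum.cong refl) (simp add: mat_block_index scalar_prod_def atLeast0LessThan)
  finally show ?thesis .
qed

lemma mat_block_one:
  assumes "i \<in> {1..n}" "j \<in> {1..n}"
  shows "mat_block d (1\<^sub>m (total_dim n d)) i j = (if i = j then 1\<^sub>m (d i) else 0\<^sub>m (d i) (d j))"
proof (rule eq_matI)
  fix r c assume "r < dim_row (if i = j then 1\<^sub>m (d i) else 0\<^sub>m (d i) (d j))"
    "c < dim_col (if i = j then 1\<^sub>m (d i) else 0\<^sub>m (d i) (d j))"
  hence rc: "r < d i" "c < d j" by (auto split: if_splits)
  have ne: "block_start d i + r \<noteq> block_start d j + c" if "i \<noteq> j"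
    using that vertex_of_block_index[of i r d] vertex_of_block_index[of j c d] rc assms by auto
  show "mat_block d (1\<^sub>m (total_dim n d)) i j $$ (r, c)
      = (if i = j then 1\<^sub>m (d i) else 0\<^sub>m (d i) (d j)) $$ (r, c)"
    using rc ne block_index_less[of i n r d] block_index_less[of j n c d] assms
    by (auto simp: mat_block_index)
qed auto

section \<open>Block-diagonal matrices\<close>

definition block_diag :: "nat \<Rightarrow> (nat \<Rightarrow> 'a::zero mat) \<Rightarrow> 'a mat" where
  "block_diag n B = diag_block_mat (map B [1..<Suc n])"

text \<open>
  The size and the entries are obtained together, by appending the last block: the position of an
  entry relative to that block depends on the size of the part before it.
\<close>

lemma block_diag_carrier_index:
  assumes "\<And>i. i \<in> {1..n} \<Longrightarrow> B i \<in> carrier_mat (d i) (d i)"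
  shows "block_diag n B \<in> carrier_mat (total_dim n d) (total_dim n d) \<and>
    (\<forall>i\<in>{1..n}. \<forall>j\<in>{1..n}. \<forall>r<d i. \<forall>c<d j.
       block_diag n B $$ (block_start d i + r, block_start d j + c)
         = (if i = j then B i $$ (r, c) else 0))"
  using assms
proof (induction n)
  case 0
  thus ?case by (simp add: total_dim_def block_diag_def)
next
  case (Suc n)
  let ?D = "block_diag n B" and ?N = "total_dim n d"
  have D: "?D \<in> carrier_mat ?N ?N"
    and idx: "\<And>i j r c. i \<in> {1..n} \<Longrightarrow> j \<in> {1..n} \<Longrightarrow> r < d i \<Longrightarrow> c < d j \<Longrightarrow>
      ?D $$ (block_start d i + r, block_start d j + c) = (if i = j then B i $$ (r, c) else 0)"
    using Suc by auto
  have B: "B (Suc n) \<in> carrier_mat (d (Suc n)) (d (Suc n))"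
    using Suc.prems by auto
  have eq: "block_diag (Suc n) B =
      four_block_mat ?D (0\<^sub>m ?N (d (Suc n))) (0\<^sub>m (d (Suc n)) ?N) (B (Suc n))"
    using D B diag_block_mat_last[of "map B [1..<Suc n]" "B (Suc n)"]
    by (simp add: Let_def block_diag_def)
  have carr: "block_diag (Suc n) B \<in> carrier_mat (total_dim (Suc n) d) (total_dim (Suc n) d)"
    unfolding eq total_dim_Suc using D B by (rule four_block_carrier_mat)
  have "block_diag (Suc n) B $$ (block_start d i + r, block_start d j + c)
         = (if i = j then B i $$ (r, c) else 0)"
    if ij: "i \<in> {1..Suc n}" "j \<in> {1..Suc n}" and rc: "r < d i" "c < d j" for i j r c
  proof -
    have split: "k \<in> {1..n} \<and> block_start d k + t < ?N \<or> k = Suc n \<and> block_start d k = ?N"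
      if "k \<in> {1..Suc n}" "t < d k" for k t
      using that block_index_less[of k n t d] by (auto simp: block_start_Suc le_Suc_eq)
    have "block_start d i + r < ?N + d (Suc n)" "block_start d j + c < ?N + d (Suc n)"
      using block_index_less[of i "Suc n" r d] block_index_less[of j "Suc n" c d] that
      by (simp_all add: total_dim_Suc)
    thus ?thesis
      unfolding eq using D B split[OF ij(1) rc(1)] split[OF ij(2) rc(2)] rc
      by (auto simp: idx)
  qed
  with carr show ?case by blast
qed

lemma block_diag_carrier:
  assumes "\<And>i. i \<in> {1..n} \<Longrightarrow> B i \<in> carrier_mat (d i) (d i)"
  shows "block_diag n B \<in> carrier_mat (total_dim n d) (total_dim n d)"
  using block_diag_carrier_index[of n B d, OF assms] by blast

lemma mat_block_block_diag:
  assumes B: "\<And>i. i \<in> {1..n} \<Longrightarrow> B i \<in> carrier_mat (d i) (d i)"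
    and "i \<in> {1..n}" "j \<in> {1..n}"
  shows "mat_block d (block_diag n B) i j = (if i = j then B i else 0\<^sub>m (d i) (d j))"
  using block_diag_carrier_index[of n B d, OF B] assms(2,3) B[OF assms(2)]
  by (intro eq_matI) (auto simp: mat_block_index)

lemma mat_block_block_diag_mult:
  fixes B :: "nat \<Rightarrow> 'a::semiring_1 mat"
  assumes B: "\<And>i. i \<in> {1..n} \<Longrightarrow> B i \<in> carrier_mat (d i) (d i)"
    and M: "M \<in> carrier_mat (total_dim n d) (total_dim n d)"
    and ij: "i \<in> {1..n}" "j \<in> {1..n}"
  shows "mat_block d (block_diag n B * M) i j = B i * mat_block d M i j"
proof (rule eq_matI)
  note Bi = B[OF ij(1)]
  fix r c assume "r < dim_row (B i * mat_block d M i j)" "c < dim_col (B i * mat_block d M i j)"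
  hence rc: "r < d i" "c < d j" using Bi by auto
  have "mat_block d (block_diag n B * M) i j $$ (r, c) =
        (\<Sum>k\<in>{1..n}. (mat_block d (block_diag n B) i k * mat_block d M k j) $$ (r, c))"
    by (rule mat_block_mult_index[OF block_diag_carrier[of n B d, OF B] M ij rc])
  also have "\<dots> = (\<Sum>k\<in>{1..n}. if k = i then (B i * mat_block d M i j) $$ (r, c) else 0)"
  proof (rule sum.cong)
    fix k assume k: "k \<in> {1..n}"
    have "mat_block d (block_diag n B) i k = (if i = k then B i else 0\<^sub>m (d i) (d k))"
      using B ij(1) k by (rule mat_block_block_diag)
    thus "(mat_block d (block_diag n B) i k * mat_block d M k j) $$ (r, c)
        = (if k = i then (B i * mat_block d M i j) $$ (r, c) else 0)"
      using rc by (auto simp: left_mult_zero_mat[OF mat_block_carrier] simp del: index_mult_mat(1))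
  qed simp
  finally show "mat_block d (block_diag n B * M) i j $$ (r, c)
      = (B i * mat_block d M i j) $$ (r, c)"
    using ij by simp
qed (use B[OF ij(1)] in auto)

lemma mat_block_mult_block_diag:
  fixes B :: "nat \<Rightarrow> 'a::semiring_1 mat"
  assumes B: "\<And>i. i \<in> {1..n} \<Longrightarrow> B i \<in> carrier_mat (d i) (d i)"
    and M: "M \<in> carrier_mat (total_dim n d) (total_dim n d)"
    and ij: "i \<in> {1..n}" "j \<in> {1..n}"
  shows "mat_block d (M * block_diag n B) i j = mat_block d M i j * B j"
proof (rule eq_matI)
  note Bj = B[OF ij(2)]
  fix r c assume "r < dim_row (mat_block d M i j * B j)" "c < dim_col (mat_block d M i j * B j)"
  hence rc: "r < d i" "c < d j" using Bj by auto
  have "mat_block d (M * block_diag n B) i j $$ (r, c) =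
        (\<Sum>k\<in>{1..n}. (mat_block d M i k * mat_block d (block_diag n B) k j) $$ (r, c))"
    by (rule mat_block_mult_index[OF M block_diag_carrier[of n B d, OF B] ij rc])
  also have "\<dots> = (\<Sum>k\<in>{1..n}. if k = j then (mat_block d M i j * B j) $$ (r, c) else 0)"
  proof (rule sum.cong)
    fix k assume k: "k \<in> {1..n}"
    have "mat_block d (block_diag n B) k j = (if k = j then B k else 0\<^sub>m (d k) (d j))"
      using B k ij(2) by (rule mat_block_block_diag)
    thus "(mat_block d M i k * mat_block d (block_diag n B) k j) $$ (r, c)
        = (if k = j then (mat_block d M i j * B j) $$ (r, c) else 0)"
      using rc by (auto simp: right_mult_zero_mat[OF mat_block_carrier] simp del: index_mult_mat(1))
  qed simp
  finally show "mat_block d (M * block_diag n B) i j $$ (r, c)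
      = (mat_block d M i j * B j) $$ (r, c)"
    using ij by simp
qed (use B[OF ij(2)] in auto)

lemma block_diag_mult:
  fixes B C :: "nat \<Rightarrow> 'a::semiring_1 mat"
  assumes B: "\<And>i. i \<in> {1..n} \<Longrightarrow> B i \<in> carrier_mat (d i) (d i)"
    and C: "\<And>i. i \<in> {1..n} \<Longrightarrow> C i \<in> carrier_mat (d i) (d i)"
  shows "block_diag n B * block_diag n C = block_diag n (\<lambda>i. B i * C i)"
proof -
  have BC: "B i * C i \<in> carrier_mat (d i) (d i)" if "i \<in> {1..n}" for i
    using B[OF that] C[OF that] by simp
  note carr = block_diag_carrier[of n _ d]
  show ?thesis
  proof (rule eq_mat_blockI[of _ n d])
    show "block_diag n B * block_diag n C \<in> carrier_mat (total_dim n d) (total_dim n d)"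
      using carr[of B, OF B] carr[of C, OF C] by (rule mult_carrier_mat)
    show "block_diag n (\<lambda>i. B i * C i) \<in> carrier_mat (total_dim n d) (total_dim n d)"
      using BC by (rule carr)
    fix i j assume ij: "i \<in> {1..n}" "j \<in> {1..n}"
    have "mat_block d (block_diag n B * block_diag n C) i j = B i * mat_block d (block_diag n C) i j"
      using mat_block_block_diag_mult[of n B d, OF B carr[of C, OF C] ij] .
    also have "mat_block d (block_diag n C) i j = (if i = j then C i else 0\<^sub>m (d i) (d j))"
      using C ij by (rule mat_block_block_diag)
    also have "B i * \<dots> = (if i = j then B i * C i else 0\<^sub>m (d i) (d j))"
      using B[OF ij(1)] by simp
    also have "\<dots> = mat_block d (block_diag n (\<lambda>i. B i * C i)) i j"
      using mat_block_block_diag[of n "\<lambda>i. B i * C i" d, OF BC ij] by simp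
    finally show "mat_block d (block_diag n B * block_diag n C) i j
        = mat_block d (block_diag n (\<lambda>i. B i * C i)) i j" .
  qed
qed

lemma block_diag_one:
  assumes "\<And>i. i \<in> {1..n} \<Longrightarrow> B i = 1\<^sub>m (d i)"
  shows "block_diag n B = 1\<^sub>m (total_dim n d)"
proof (rule eq_mat_blockI)
  have B: "B i \<in> carrier_mat (d i) (d i)" if "i \<in> {1..n}" for i
    using assms[OF that] by simp
  show "block_diag n B \<in> carrier_mat (total_dim n d) (total_dim n d)"
    using B by (rule block_diag_carrier)
  show "mat_block d (block_diag n B) i j = mat_block d (1\<^sub>m (total_dim n d)) i j"
    if "i \<in> {1..n}" "j \<in> {1..n}" for i j
    using mat_block_block_diag[of n B d, OF B that] assms[OF that(1)]
    by (auto simp: mat_block_one[OF that])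
qed simp

text \<open>
  The diagonal blocks of \<open>Q\<close> invert the matrices \<open>B i\<close>, as one sees from the diagonal blocks of the
  two products. Hence they form a block-diagonal inverse of \<open>block_diag n B\<close>, and inverses are
  unique.
\<close>

lemma inverse_of_block_diag:
  fixes B :: "nat \<Rightarrow> 'a::semiring_1 mat"
  assumes B: "\<And>i. i \<in> {1..n} \<Longrightarrow> B i \<in> carrier_mat (d i) (d i)"
    and Q: "Q \<in> carrier_mat (total_dim n d) (total_dim n d)"
    and BQ: "block_diag n B * Q = 1\<^sub>m (total_dim n d)"
    and QB: "Q * block_diag n B = 1\<^sub>m (total_dim n d)"
  obtains C where "\<And>i. i \<in> {1..n} \<Longrightarrow> C i \<in> carrier_mat (d i) (d i)"
    and "\<And>i. i \<in> {1..n} \<Longrightarrow> B i * C i = 1\<^sub>m (d i)"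
    and "\<And>i. i \<in> {1..n} \<Longrightarrow> C i * B i = 1\<^sub>m (d i)"
    and "Q = block_diag n C"
proof -
  define C where "C i = mat_block d Q i i" for i
  have C: "C i \<in> carrier_mat (d i) (d i)" for i
    by (simp add: C_def)
  have 1: "B i * C i = 1\<^sub>m (d i)" if "i \<in> {1..n}" for i
    using mat_block_block_diag_mult[of n B d, OF B Q that that]
    by (simp add: C_def BQ mat_block_one[OF that that])
  have 2: "C i * B i = 1\<^sub>m (d i)" if "i \<in> {1..n}" for i
    using mat_block_mult_block_diag[of n B d, OF B Q that that]
    by (simp add: C_def QB mat_block_one[OF that that])
  let ?B = "block_diag n B" and ?C = "block_diag n C" and ?N = "total_dim n d"
  have carr: "?B \<in> carrier_mat ?N ?N" "?C \<in> carrier_mat ?N ?N"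
    using B C by (intro block_diag_carrier; blast)+
  have "?B * ?C = 1\<^sub>m ?N"
    using block_diag_mult[of n B d C, OF B C] block_diag_one[of n "\<lambda>i. B i * C i" d, OF 1] by simp
  hence "Q = Q * (?B * ?C)"
    using Q by simp
  also have "\<dots> = ?C"
    using Q carr QB by (simp add: assoc_mult_mat[symmetric, of _ ?N ?N _ ?N _ ?N])
  finally show thesis
    using that C 1 2 by blast
qed

section \<open>Block-diagonal similarity\<close>

definition block_similar ::
  "nat \<Rightarrow> (nat \<Rightarrow> nat) \<Rightarrow> 'a::semiring_1 mat \<Rightarrow> 'a mat \<Rightarrow> bool" where
  "block_similar n d A L \<longleftrightarrow>
     (\<exists>B Q. (\<forall>i\<in>{1..n}. B i \<in> carrier_mat (d i) (d i)) \<and> similar_mat_wit A L (block_diag n B) Q)"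

lemma block_similar_cong:
  "(\<And>i. i \<in> {1..n} \<Longrightarrow> d i = d' i) \<Longrightarrow> block_similar n d A L \<longleftrightarrow> block_similar n d' A L"
  by (simp add: block_similar_def)

text \<open>
  An arbitrary witness \<open>Q\<close> of the similarity may be replaced by an explicitly block-diagonal one.
\<close>

lemma block_similarE:
  fixes A L :: "'a::semiring_1 mat"
  assumes "block_similar n d A L"
  obtains B C where "\<And>i. i \<in> {1..n} \<Longrightarrow> B i \<in> carrier_mat (d i) (d i)"
    and "\<And>i. i \<in> {1..n} \<Longrightarrow> C i \<in> carrier_mat (d i) (d i)"
    and "\<And>i. i \<in> {1..n} \<Longrightarrow> B i * C i = 1\<^sub>m (d i)"
    and "\<And>i. i \<in> {1..n} \<Longrightarrow> C i * B i = 1\<^sub>m (d i)"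
    and "similar_mat_wit A L (block_diag n B) (block_diag n C)"
proof -
  obtain B Q where B: "\<And>i. i \<in> {1..n} \<Longrightarrow> B i \<in> carrier_mat (d i) (d i)"
    and sim: "similar_mat_wit A L (block_diag n B) Q"
    using assms unfolding block_similar_def by blast
  have "block_diag n B \<in> carrier_mat (total_dim n d) (total_dim n d)"
    using B by (rule block_diag_carrier)
  moreover have "block_diag n B \<in> carrier_mat (dim_row A) (dim_row A)"
    using similar_mat_witD(6)[OF refl sim] .
  ultimately have "dim_row A = total_dim n d" by auto
  note s = similar_mat_witD[OF this[symmetric] sim]
  obtain C where "\<And>i. i \<in> {1..n} \<Longrightarrow> C i \<in> carrier_mat (d i) (d i)"
    "\<And>i. i \<in> {1..n} \<Longrightarrow> B i * C i = 1\<^sub>m (d i)" "\<And>i. i \<in> {1..n} \<Longrightarrow> C i * B i = 1\<^sub>m (d i)"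
    "Q = block_diag n C"
    using inverse_of_block_diag[of n B d Q, OF B s(7) s(1) s(2)] by blast
  thus thesis using that B sim by blast
qed

lemma block_similar_sym:
  assumes "block_similar n d A L"
  shows "block_similar n d L A"
proof -
  obtain B C where "\<And>i. i \<in> {1..n} \<Longrightarrow> C i \<in> carrier_mat (d i) (d i)"
    and "similar_mat_wit A L (block_diag n B) (block_diag n C)"
    using assms by (rule block_similarE) blast
  thus ?thesis
    unfolding block_similar_def using similar_mat_wit_sym by blast
qed

lemma block_similar_trans:
  assumes "block_similar n d A L" "block_similar n d L M"
  shows "block_similar n d A M"
proof -
  obtain B Q where B: "\<And>i. i \<in> {1..n} \<Longrightarrow> B i \<in> carrier_mat (d i) (d i)"
    and 1: "similar_mat_wit A L (block_diag n B) Q"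
    using assms(1) unfolding block_similar_def by blast
  obtain B' Q' where B': "\<And>i. i \<in> {1..n} \<Longrightarrow> B' i \<in> carrier_mat (d i) (d i)"
    and 2: "similar_mat_wit L M (block_diag n B') Q'"
    using assms(2) unfolding block_similar_def by blast
  have "similar_mat_wit A M (block_diag n (\<lambda>i. B i * B' i)) (Q' * Q)"
    using similar_mat_wit_trans[OF 1 2] block_diag_mult[of n B d B', OF B B'] by simp
  moreover have "\<forall>i\<in>{1..n}. B i * B' i \<in> carrier_mat (d i) (d i)"
    using B B' mult_carrier_mat by blast
  ultimately show ?thesis
    unfolding block_similar_def by (intro exI conjI)
qed

section \<open>Companion matrices\<close>

lemma total_dim_cong:
  "(\<And>i. i \<in> {1..n} \<Longrightarrow> d i = d' i) \<Longrightarrow> total_dim n d = total_dim n d'"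
  by (simp add: total_dim_def)

text \<open>
  Isomorphic representations agree in dimension at the vertices \<open>1, \<dots>, n\<close> only; their dimension
  functions may differ elsewhere. Congruence rules of this kind bridge the gap.
\<close>

lemma mat_block_cong:
  assumes "\<And>i. i \<in> {1..n} \<Longrightarrow> d i = d' i" "i \<in> {1..n}" "j \<in> {1..n}"
  shows "mat_block d M i j = mat_block d' M i j"
proof -
  have "block_start d k = block_start d' k" if "k \<in> {1..n}" for k
    using that assms(1) by (simp add: block_start_def)
  with assms show ?thesis by (simp add: mat_block_def)
qed

lemma companion_matrix_carrier:
  "companion_matrix n fwd R \<in> carrier_mat (total_dim n (vdim R)) (total_dim n (vdim R))"
  by (simp add: companion_matrix_def)

lemma source_target_vertex:
  "e \<in> {1..<n} \<Longrightarrow> source fwd e \<in> {1..n}" "e \<in> {1..<n} \<Longrightarrow> target fwd e \<in> {1..n}"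
  by (auto simp: source_def target_def)

text \<open>
  There are no loops or multiple edges, so a block of a companion matrix meets at most one edge map.
\<close>

lemma edge_unique:
  "target fwd e = target fwd e' \<Longrightarrow> source fwd e = source fwd e' \<Longrightarrow> e = e'"
  by (auto simp: source_def target_def split: if_splits)

lemma mat_block_companion_index:
  assumes "i \<in> {1..n}" "j \<in> {1..n}" "r < vdim R i" "c < vdim R j"
  shows "mat_block (vdim R) (companion_matrix n fwd R) i j $$ (r, c) =
    (\<Sum>e | e \<in> {1..<n} \<and> target fwd e = i \<and> source fwd e = j. emap R e $$ (r, c))"
  using assms block_index_less[of i n r "vdim R"] block_index_less[of j n c "vdim R"]
  by (simp add: mat_block_index companion_matrix_def vertex_of_block_index)

lemma mat_block_companion_edge:
  assumes "is_rep n fwd R" and e: "e \<in> {1..<n}"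
  shows "mat_block (vdim R) (companion_matrix n fwd R) (target fwd e) (source fwd e) = emap R e"
proof -
  have "{e'. e' \<in> {1..<n} \<and> target fwd e' = target fwd e \<and> source fwd e' = source fwd e} = {e}"
    using e edge_unique by blast
  moreover have "emap R e \<in> carrier_mat (vdim R (target fwd e)) (vdim R (source fwd e))"
    using assms by (auto simp: is_rep_def)
  ultimately show ?thesis
    using source_target_vertex[OF e, of fwd]
    by (intro eq_matI) (auto simp: mat_block_companion_index simp del: atLeastLessThan_iff)
qed

lemma mat_block_companion_no_edge:
  assumes "i \<in> {1..n}" "j \<in> {1..n}"
    and no: "\<not> (\<exists>e\<in>{1..<n}. target fwd e = i \<and> source fwd e = j)"
  shows "mat_block (vdim R) (companion_matrix n fwd R) i j = 0\<^sub>m (vdim R i) (vdim R j)"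
  using assms by (intro eq_matI) (auto simp: mat_block_companion_index intro!: sum.neutral)

text \<open>
  Compare the two products block by block. At the block of an edge the equation says that the
  square of this edge commutes; at every other block both sides vanish.
\<close>

lemma block_diag_intertwines_companion_iff:
  fixes R S :: "'a::field quiver_rep"
  assumes R: "is_rep n fwd R" and S: "is_rep n fwd S"
    and dims: "\<And>i. i \<in> {1..n} \<Longrightarrow> vdim S i = vdim R i"
    and B: "\<And>i. i \<in> {1..n} \<Longrightarrow> B i \<in> carrier_mat (vdim R i) (vdim R i)"
  shows "block_diag n B * companion_matrix n fwd R = companion_matrix n fwd S * block_diag n B \<longleftrightarrow>
     (\<forall>e\<in>{1..<n}. B (target fwd e) * emap R e = emap S e * B (source fwd e))"
    (is "?D * ?R = ?S * ?D \<longleftrightarrow> _")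
proof -
  let ?d = "vdim R" and ?N = "total_dim n (vdim R)"
  have carr: "?D \<in> carrier_mat ?N ?N" "?R \<in> carrier_mat ?N ?N" "?S \<in> carrier_mat ?N ?N"
    using block_diag_carrier[of n B ?d, OF B] companion_matrix_carrier[of n fwd R]
      companion_matrix_carrier[of n fwd S] total_dim_cong[of n "vdim S" ?d, OF dims] by simp_all
  have blocks: "mat_block ?d (?D * ?R) i j = B i * mat_block ?d ?R i j"
    "mat_block ?d (?S * ?D) i j = mat_block (vdim S) ?S i j * B j"
    if ij: "i \<in> {1..n}" "j \<in> {1..n}" for i j
  proof -
    have "mat_block (vdim S) ?S i j = mat_block ?d ?S i j"
      using dims ij by (rule mat_block_cong)
    thus "mat_block ?d (?D * ?R) i j = B i * mat_block ?d ?R i j"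
      "mat_block ?d (?S * ?D) i j = mat_block (vdim S) ?S i j * B j"
      using mat_block_block_diag_mult[of n B ?d, OF B carr(2) ij]
        mat_block_mult_block_diag[of n B ?d, OF B carr(3) ij] by simp_all
  qed
  show ?thesis
  proof
    assume eq: "?D * ?R = ?S * ?D"
    show "\<forall>e\<in>{1..<n}. B (target fwd e) * emap R e = emap S e * B (source fwd e)"
    proof
      fix e assume e: "e \<in> {1..<n}"
      note v = source_target_vertex[OF e, of fwd]
      show "B (target fwd e) * emap R e = emap S e * B (source fwd e)"
        using blocks[OF v(2,1)] eq mat_block_companion_edge[OF R e] mat_block_companion_edge[OF S e]
        by simp
    qed
  next
    assume comm: "\<forall>e\<in>{1..<n}. B (target fwd e) * emap R e = emap S e * B (source fwd e)"
    show "?D * ?R = ?S * ?D"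
    proof (rule eq_mat_blockI[of _ n ?d])
      fix i j assume ij: "i \<in> {1..n}" "j \<in> {1..n}"
      have "B i * mat_block ?d ?R i j = mat_block (vdim S) ?S i j * B j"
      proof (cases "\<exists>e\<in>{1..<n}. target fwd e = i \<and> source fwd e = j")
        case True
        then obtain e where e: "e \<in> {1..<n}" and "target fwd e = i" "source fwd e = j" by blast
        thus ?thesis
          using comm mat_block_companion_edge[OF R e] mat_block_companion_edge[OF S e] by auto
      next
        case False
        thus ?thesis
          using B[OF ij(1)] B[OF ij(2)] ij dims
          by (simp add: mat_block_companion_no_edge)
      qed
      thus "mat_block ?d (?D * ?R) i j = mat_block ?d (?S * ?D) i j"
        using blocks[OF ij] by simp
    qed (use carr mult_carrier_mat in blast)+
  qed
qed

lemma rep_iso_vdim: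
  fixes R S :: "'a::field quiver_rep"
  assumes "rep_iso n fwd R S" "i \<in> {1..n}"
  shows "vdim S i = vdim R i"
proof -
  obtain B :: "'a mat" where "B \<in> carrier_mat (vdim S i) (vdim R i)" "invertible_mat B"
    using assms unfolding rep_iso_def by blast
  thus ?thesis by (auto simp: invertible_mat_def)
qed

text \<open>
  An intertwiner of the companion matrices is a similarity as soon as it is invertible, and a
  block-diagonal matrix is invertible iff its blocks are.
\<close>

lemma rep_iso_iff_block_similar:
  fixes R S :: "'a::field quiver_rep"
  assumes R: "is_rep n fwd R" and S: "is_rep n fwd S"
    and dims: "\<And>i. i \<in> {1..n} \<Longrightarrow> vdim S i = vdim R i"
  shows "rep_iso n fwd R S \<longleftrightarrow>
     block_similar n (vdim R) (companion_matrix n fwd S) (companion_matrix n fwd R)"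
    (is "_ \<longleftrightarrow> block_similar n ?d ?S ?R")
proof -
  let ?N = "total_dim n ?d"
  have carr: "?R \<in> carrier_mat ?N ?N" "?S \<in> carrier_mat ?N ?N"
    using companion_matrix_carrier[of n fwd R] companion_matrix_carrier[of n fwd S]
      total_dim_cong[of n "vdim S" ?d, OF dims] by simp_all
  show ?thesis
  proof
    assume "rep_iso n fwd R S"
    then obtain B where B: "\<And>i. i \<in> {1..n} \<Longrightarrow> B i \<in> carrier_mat (?d i) (?d i)"
      and inv: "\<And>i. i \<in> {1..n} \<Longrightarrow> invertible_mat (B i)"
      and comm: "\<forall>e\<in>{1..<n}. B (target fwd e) * emap R e = emap S e * B (source fwd e)"
      using dims unfolding rep_iso_def by fastforce
    have "\<exists>C. C \<in> carrier_mat (?d i) (?d i) \<and> B i * C = 1\<^sub>m (?d i) \<and> C * B i = 1\<^sub>m (?d i)"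
      if i: "i \<in> {1..n}" for i
    proof -
      obtain C where BC: "B i * C = 1\<^sub>m (dim_row (B i))" and CB: "C * B i = 1\<^sub>m (dim_row C)"
        using inv[OF i] unfolding invertible_mat_def inverts_mat_def by blast
      \<comment> \<open>The size of the inverse is read off from the sizes of the two identity matrices.\<close>
      have "dim_col C = ?d i" "dim_row C = ?d i"
        using B[OF i] arg_cong[OF BC, of dim_col] arg_cong[OF CB, of dim_col] by auto
      thus ?thesis using BC CB B[OF i] by auto
    qed
    then obtain C where C: "\<And>i. i \<in> {1..n} \<Longrightarrow> C i \<in> carrier_mat (?d i) (?d i)"
      and BC: "\<And>i. i \<in> {1..n} \<Longrightarrow> B i * C i = 1\<^sub>m (?d i)"
      and CB: "\<And>i. i \<in> {1..n} \<Longrightarrow> C i * B i = 1\<^sub>m (?d i)"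
      by metis
    let ?B = "block_diag n B" and ?C = "block_diag n C"
    have carr': "?B \<in> carrier_mat ?N ?N" "?C \<in> carrier_mat ?N ?N"
      using block_diag_carrier[of n B ?d, OF B] block_diag_carrier[of n C ?d, OF C] by simp_all
    have 1: "?B * ?C = 1\<^sub>m ?N" "?C * ?B = 1\<^sub>m ?N"
      using block_diag_mult[of n B ?d C, OF B C] block_diag_mult[of n C ?d B, OF C B]
        block_diag_one[of n "\<lambda>i. B i * C i" ?d, OF BC]
        block_diag_one[of n "\<lambda>i. C i * B i" ?d, OF CB]
      by simp_all
    have "?B * ?R * ?C = ?S * ?B * ?C"
      using block_diag_intertwines_companion_iff[of n fwd R S B, OF R S dims B] comm by simp
    also have "\<dots> = ?S"
      using carr carr' 1 by (simp add: assoc_mult_mat[of _ ?N ?N _ ?N _ ?N])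
    finally have "?S = ?B * ?R * ?C" by simp
    hence "similar_mat_wit ?S ?R ?B ?C"
      using 1 carr carr' by (intro similar_mat_witI[of _ _ ?N])
    thus "block_similar n ?d ?S ?R"
      unfolding block_similar_def using B by blast
  next
    assume "block_similar n ?d ?S ?R"
    then obtain B C where B: "\<And>i. i \<in> {1..n} \<Longrightarrow> B i \<in> carrier_mat (?d i) (?d i)"
      and C: "\<And>i. i \<in> {1..n} \<Longrightarrow> C i \<in> carrier_mat (?d i) (?d i)"
      and BC: "\<And>i. i \<in> {1..n} \<Longrightarrow> B i * C i = 1\<^sub>m (?d i)"
      and CB: "\<And>i. i \<in> {1..n} \<Longrightarrow> C i * B i = 1\<^sub>m (?d i)"
      and sim: "similar_mat_wit ?S ?R (block_diag n B) (block_diag n C)"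
      by (rule block_similarE) blast
    let ?B = "block_diag n B" and ?C = "block_diag n C"
    note s = similar_mat_witD2[OF carr(2) sim]
    have "?S * ?B = ?B * ?R * (?C * ?B)"
      unfolding s(3) using s(5-7) by (simp add: assoc_mult_mat[of _ ?N ?N _ ?N _ ?N])
    also have "\<dots> = ?B * ?R"
      unfolding s(2) using s(5,6) by simp
    finally have "?B * ?R = ?S * ?B" by simp
    hence "\<forall>e\<in>{1..<n}. B (target fwd e) * emap R e = emap S e * B (source fwd e)"
      using block_diag_intertwines_companion_iff[of n fwd R S B, OF R S dims B] by simp
    moreover have "B i \<in> carrier_mat (vdim S i) (?d i) \<and> invertible_mat (B i)"
      if i: "i \<in> {1..n}" for i
      using B[OF i] C[OF i] BC[OF i] CB[OF i] dims[OF i]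
      unfolding invertible_mat_def inverts_mat_def by auto
    ultimately show "rep_iso n fwd R S"
      unfolding rep_iso_def by blast
  qed
qed

section \<open>Barcode forms classify\<close>

lemma barcode_form_of_iff:
  "barcode_form_of n fwd R \<delta> L \<longleftrightarrow>
     in_barcode_form n fwd \<delta> L \<and> (\<forall>i\<in>{1..n}. \<delta> i = vdim R i) \<and>
     block_similar n (vdim R) (companion_matrix n fwd R) L"
  by (simp only: barcode_form_of_def block_similar_def block_diag_def)

theorem theorem1:
  fixes n :: nat and fwd :: "nat \<Rightarrow> bool"
    and R S :: "'a::field quiver_rep"
    and \<delta> :: "nat \<Rightarrow> nat" and \<Lambda> :: "'a mat"
  assumes "n \<ge> 1"
    and "is_rep n fwd R" and "is_rep n fwd S"
    and "barcode_form_of n fwd R \<delta> \<Lambda>"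
  shows "barcode_form_of n fwd S \<delta> \<Lambda> \<longleftrightarrow> rep_iso n fwd R S"
proof -
  let ?d = "vdim R" and ?R = "companion_matrix n fwd R" and ?S = "companion_matrix n fwd S"
  have R: "in_barcode_form n fwd \<delta> \<Lambda>" "\<forall>i\<in>{1..n}. \<delta> i = ?d i" "block_similar n ?d ?R \<Lambda>"
    using assms(4) by (auto simp: barcode_form_of_iff)
  \<comment> \<open>Either side of the equivalence forces \<open>R\<close> and \<open>S\<close> to have the same dimensions.\<close>
  have "barcode_form_of n fwd S \<delta> \<Lambda> \<longleftrightarrow> rep_iso n fwd R S"
    if dims: "\<And>i. i \<in> {1..n} \<Longrightarrow> vdim S i = ?d i"
  proof -
    have "barcode_form_of n fwd S \<delta> \<Lambda> \<longleftrightarrow> block_similar n ?d ?S \<Lambda>"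
      using R(1,2) dims block_similar_cong[of n "vdim S" ?d, OF dims]
      by (auto simp: barcode_form_of_iff)
    also have "\<dots> \<longleftrightarrow> block_similar n ?d ?S ?R"
      using R(3) block_similar_sym block_similar_trans by blast
    also have "\<dots> \<longleftrightarrow> rep_iso n fwd R S"
      using rep_iso_iff_block_similar[OF assms(2,3) dims] by simp
    finally show ?thesis .
  qed
  moreover have "vdim S i = ?d i" if "barcode_form_of n fwd S \<delta> \<Lambda>" "i \<in> {1..n}" for i
    using that R(2) by (auto simp: barcode_form_of_iff)
  ultimately show ?thesis
    using rep_iso_vdim by blast
qed

end
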